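(* Suppose $\Sigma_0,\Sigma_1\subset\mathbb{R}^{n+1}$ are complete, properly embedded $n$-dimensional shrinkers, i.e. smooth hypersurfaces satisfying $\vec H=-\tfrac12 x^\perp$, where $\vec H$ is the Euclidean mean curvature vector and $x^\perp$ the normal component of the position vector. Then $$\overline{B^{n+1}_{2\sqrt n}}\cap\Sigma_0\cap\Sigma_1\neq\emptyset,$$ where $B^{n+1}_{2\sqrt n}$ is the open Euclidean ball of radius $2\sqrt n$ centered at the origin. *)

theory Defs
  imports "HOL-Analysis.Analysis"
begin

fun Ck :: "nat \<Rightarrow> 'a::euclidean_space set \<Rightarrow> ('a \<Rightarrow> real) \<Rightarrow> bool" where
  "Ck 0 U f = continuous_on U f"
| "Ck (Suc k) U f =
     ((\<forall>x\<in>U. f differentiable (at x)) \<and>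
      (\<forall>b\<in>Basis. Ck k U (\<lambda>x. frechet_derivative f (at x) b)))"

definition smooth_on :: "'a::euclidean_space set \<Rightarrow> ('a \<Rightarrow> real) \<Rightarrow> bool" where
  "smooth_on U f \<longleftrightarrow> (\<forall>k. Ck k U f)"

definition grad :: "('a::euclidean_space \<Rightarrow> real) \<Rightarrow> 'a \<Rightarrow> 'a" where
  "grad u x = (\<Sum>b\<in>Basis. frechet_derivative u (at x) b *\<^sub>R b)"

definition divergence :: "('a::euclidean_space \<Rightarrow> 'a) \<Rightarrow> 'a \<Rightarrow> real" where
  "divergence V x = (\<Sum>b\<in>Basis. frechet_derivative (\<lambda>y. V y \<bullet> b) (at x) b)"

definition unit_normal :: "('a::euclidean_space \<Rightarrow> real) \<Rightarrow> 'a \<Rightarrow> 'a" where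
  "unit_normal u x = (1 / norm (grad u x)) *\<^sub>R grad u x"

text \<open>Mean curvature vector of the level set {u = 0} at x (convention: H = - div(nu) nu,
so that spheres have inward-pointing mean curvature vector).\<close>
definition mean_curvature_vector :: "('a::euclidean_space \<Rightarrow> real) \<Rightarrow> 'a \<Rightarrow> 'a" where
  "mean_curvature_vector u x = - (divergence (unit_normal u) x *\<^sub>R unit_normal u x)"

definition local_defining_function :: "'a::euclidean_space set \<Rightarrow> 'a set \<Rightarrow> ('a \<Rightarrow> real) \<Rightarrow> bool" where
  "local_defining_function S U u \<longleftrightarrow>
     open U \<and> smooth_on U u \<and> (\<forall>x\<in>U. grad u x \<noteq> 0) \<and> S \<inter> U = {x\<in>U. u x = 0}"

text \<open>A (nonempty) properly embedded smooth hypersurface: a closed subset which is locally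
a regular level set of a smooth function. Properly embedded = embedded and closed;
completeness of the induced metric follows from closedness.\<close>
definition properly_embedded_hypersurface :: "'a::euclidean_space set \<Rightarrow> bool" where
  "properly_embedded_hypersurface S \<longleftrightarrow> S \<noteq> {} \<and> closed S \<and>
     (\<forall>p\<in>S. \<exists>U u. p \<in> U \<and> local_defining_function S U u)"

definition shrinker :: "'a::euclidean_space set \<Rightarrow> bool" where
  "shrinker S \<longleftrightarrow> properly_embedded_hypersurface S \<and>
     (\<forall>p\<in>S. \<forall>U u. p \<in> U \<and> local_defining_function S U u \<longrightarrow>
        mean_curvature_vector u p = - (1/2) *\<^sub>R ((p \<bullet> unit_normal u p) *\<^sub>R unit_normal u p))"

end

theory Submission
  imports Defs
begin

text \<open>
  Suppose the shrinkers are disjoint in the closed ball of radius \<open>2 \<surd>n\<close>, hence in a slightly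
  larger one of radius \<open>\<surd>\<rho>\<close> with \<open>\<rho> > 4 n\<close>. Among pairs \<open>x \<in> S0\<close>, \<open>y \<in> S1\<close> in that ball minimise
  \<open>|x - y|\<^sup>2 / (a b)\<close> with \<open>a = \<rho> - |x|\<^sup>2\<close>, \<open>b = \<rho> - |y|\<^sup>2\<close>, which is a monotone function of the
  hyperbolic distance in the ball; a minimum with \<open>a, b > 0\<close> exists because every shrinker meets
  the ball of radius \<open>\<surd>(2 n)\<close>. Let \<open>c\<close> be the minimum, so that \<open>|x - y|\<^sup>2 - c a b \<ge> 0\<close> on the
  product. The first variation says that \<open>P = (1 + c b) x - y\<close> and \<open>Q = (1 + c a) y - x\<close> are
  normal to \<open>S0\<close> and \<open>S1\<close>, and the reflection \<open>A\<close> in \<open>x - y\<close> maps the line of \<open>P\<close> to that of \<open>Q\<close>,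
  hence one tangent space to the other. The second variation in the direction \<open>(e, A e)\<close>, summed
  over an orthonormal basis of the tangent space of \<open>S0\<close>, collapses by the shrinker equation to
  \<open>(2 n - \<rho>) (a + b) + a b \<ge> 0\<close>, which contradicts \<open>\<rho> > 4 n\<close> and \<open>0 < a, b \<le> \<rho>\<close>.
\<close>

section \<open>Second-order expansions\<close>

text \<open>For nonzero \<open>s\<close> the equation merely defines \<open>r s\<close>, and at
  \<open>s = 0\<close> it forces \<open>f 0 = f0\<close>; the content is the one-sided limit of
  \<open>r\<close>. Continuity of \<open>f\<close> at other parameters is not demanded, so curves
  chosen separately for each \<open>s\<close> qualify. The coefficient \<open>f2\<close> is half of
  a second derivative.\<close>

definition expands2 :: "(real \<Rightarrow> 'b::real_normed_vector) \<Rightarrow> 'b \<Rightarrow> 'b \<Rightarrow> 'b \<Rightarrow> bool" where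
  "expands2 f f0 f1 f2 \<longleftrightarrow>
     (\<exists>r. (r \<longlongrightarrow> f2) (at_right 0) \<and> (\<forall>s. f s = f0 + s *\<^sub>R f1 + s\<^sup>2 *\<^sub>R r s))"

lemma expands2_const: "expands2 (\<lambda>_. c) c 0 0"
  unfolding expands2_def by (rule exI[of _ "\<lambda>_. 0"]) auto

lemma expands2_diff:
  assumes "expands2 f f0 f1 f2" "expands2 g g0 g1 g2"
  shows "expands2 (\<lambda>s. f s - g s) (f0 - g0) (f1 - g1) (f2 - g2)"
proof -
  obtain r where r: "(r \<longlongrightarrow> f2) (at_right 0)" "\<And>s. f s = f0 + s *\<^sub>R f1 + s\<^sup>2 *\<^sub>R r s"
    using assms(1) unfolding expands2_def by blast
  obtain q where q: "(q \<longlongrightarrow> g2) (at_right 0)" "\<And>s. g s = g0 + s *\<^sub>R g1 + s\<^sup>2 *\<^sub>R q s"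
    using assms(2) unfolding expands2_def by blast
  show ?thesis unfolding expands2_def
    by (rule exI[of _ "\<lambda>s. r s - q s"])
      (auto intro!: tendsto_diff r(1) q(1) simp: r(2) q(2) algebra_simps)
qed

lemma expands2_bilinear:
  assumes "bounded_bilinear bp" and "expands2 f f0 f1 f2" "expands2 g g0 g1 g2"
  shows "expands2 (\<lambda>s. bp (f s) (g s)) (bp f0 g0) (bp f0 g1 + bp f1 g0)
           (bp f0 g2 + bp f1 g1 + bp f2 g0)"
proof -
  interpret bounded_bilinear bp by fact
  obtain r where r: "(r \<longlongrightarrow> f2) (at_right 0)" "\<And>s. f s = f0 + s *\<^sub>R f1 + s\<^sup>2 *\<^sub>R r s"
    using assms(2) unfolding expands2_def by blast
  obtain q where q: "(q \<longlongrightarrow> g2) (at_right 0)" "\<And>s. g s = g0 + s *\<^sub>R g1 + s\<^sup>2 *\<^sub>R q s"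
    using assms(3) unfolding expands2_def by blast
  \<comment> \<open>\<open>w\<close> collects all terms of the product of order two and higher,
    divided by the square of \<open>s\<close>.\<close>
  define w where "w s = bp f0 (q s) + bp f1 g1 + bp (r s) g0
    + s *\<^sub>R (bp f1 (q s) + bp (r s) g1) + s\<^sup>2 *\<^sub>R bp (r s) (q s)" for s
  have "(w \<longlongrightarrow> bp f0 g2 + bp f1 g1 + bp f2 g0
      + 0 *\<^sub>R (bp f1 g2 + bp f2 g1) + 0\<^sup>2 *\<^sub>R bp f2 g2) (at_right 0)"
    unfolding w_def by (intro tendsto_intros tendsto r(1) q(1))
  moreover have "bp (f s) (g s)
      = bp f0 g0 + s *\<^sub>R (bp f0 g1 + bp f1 g0) + s\<^sup>2 *\<^sub>R w s" for s
    by (simp add: w_def r(2) q(2) add_left add_right scaleR_left scaleR_right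
        power2_eq_square algebra_simps)
  ultimately show ?thesis unfolding expands2_def by (intro exI[of _ w]) auto
qed

lemmas expands2_inner = expands2_bilinear[OF bounded_bilinear_inner]
lemmas expands2_mult = expands2_bilinear[OF bounded_bilinear_mult]

lemma expands2_tendsto:
  assumes "expands2 f f0 f1 f2"
  shows "(f \<longlongrightarrow> f0) (at_right 0)"
proof -
  obtain r where r: "(r \<longlongrightarrow> f2) (at_right 0)" "\<And>s. f s = f0 + s *\<^sub>R f1 + s\<^sup>2 *\<^sub>R r s"
    using assms(1) unfolding expands2_def by blast
  have "((\<lambda>s. f0 + s *\<^sub>R f1 + s\<^sup>2 *\<^sub>R r s) \<longlongrightarrow> f0 + 0 *\<^sub>R f1 + 0\<^sup>2 *\<^sub>R f2) (at_right 0)"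
    by (intro tendsto_intros r(1))
  moreover have "f = (\<lambda>s. f0 + s *\<^sub>R f1 + s\<^sup>2 *\<^sub>R r s)" using r(2) by blast
  ultimately show ?thesis by simp
qed

text \<open>Dividing by \<open>s > 0\<close> keeps the sign, and the quotient
  \<open>f1 + s * r s\<close> tends to \<open>f1\<close>. One-sided curves give only an inequality;
  opposite directions later turn it into an equality.\<close>

lemma expands2_nonneg_first:
  fixes f :: "real \<Rightarrow> real"
  assumes "expands2 f 0 f1 f2" and nonneg: "\<forall>\<^sub>F s in at_right 0. f s \<ge> 0"
  shows "f1 \<ge> 0"
proof -
  obtain r where r: "(r \<longlongrightarrow> f2) (at_right 0)" "\<And>s. f s = s * f1 + s\<^sup>2 * r s"
    using assms(1) unfolding expands2_def by auto
  have "((\<lambda>s. f1 + s * r s) \<longlongrightarrow> f1 + 0 * f2) (at_right 0)"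
    by (intro tendsto_intros r(1))
  moreover have "\<forall>\<^sub>F s in at_right 0. 0 \<le> f1 + s * r s"
    using nonneg eventually_at_right_less[of 0]
  proof eventually_elim
    case (elim s)
    then have "0 \<le> s * (f1 + s * r s)" by (simp add: r(2) power2_eq_square algebra_simps)
    with elim show ?case by (simp add: zero_le_mult_iff)
  qed
  ultimately have "0 \<le> f1 + 0 * f2"
    by (rule tendsto_lowerbound) simp
  then show ?thesis by simp
qed

lemma expands2_nonneg_second:
  fixes f :: "real \<Rightarrow> real"
  assumes "expands2 f 0 0 f2" and nonneg: "\<forall>\<^sub>F s in at_right 0. f s \<ge> 0"
  shows "f2 \<ge> 0"
proof -
  obtain r where r: "(r \<longlongrightarrow> f2) (at_right 0)" "\<And>s. f s = s\<^sup>2 * r s"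
    using assms(1) unfolding expands2_def by auto
  have "\<forall>\<^sub>F s in at_right 0. 0 \<le> r s"
    using nonneg eventually_at_right_less[of 0]
    by eventually_elim (auto simp: r(2) zero_le_mult_iff)
  then show ?thesis
    using tendsto_lowerbound[OF r(1)] by simp
qed

text \<open>Curves are one-sided (parameter \<open>s > 0\<close>), and \<open>w\<close> is half of the acceleration.\<close>

definition admits_curve :: "'a::real_normed_vector set \<Rightarrow> 'a \<Rightarrow> 'a \<Rightarrow> 'a \<Rightarrow> bool" where
  "admits_curve S p v w \<longleftrightarrow>
     (\<exists>\<gamma>. expands2 \<gamma> p v w \<and> (\<forall>\<^sub>F s in at_right 0. \<gamma> s \<in> S))"

text \<open>Lets one of two points stay fixed while the other one moves.\<close>

lemma admits_curve_const: "p \<in> S \<Longrightarrow> admits_curve S p 0 0"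
  unfolding admits_curve_def by (rule exI[of _ "\<lambda>_. p"]) (simp add: expands2_const)

section \<open>Orthogonal transformations and traces\<close>

text \<open>At \<open>d = 0\<close> the formula is the identity, so
  \<open>reflection (x - y)\<close> still maps \<open>x\<close> to \<open>y\<close> when
  \<open>x = y\<close>.\<close>

definition reflection :: "'a::real_inner \<Rightarrow> 'a \<Rightarrow> 'a" where
  "reflection d v = v - (2 * (v \<bullet> d) / (d \<bullet> d)) *\<^sub>R d"

lemma orthogonal_transformation_reflection: "orthogonal_transformation (reflection d)"
proof (cases "d = 0")
  case True
  then have "reflection d = (\<lambda>v. v)" by (auto simp: reflection_def)
  then show ?thesis by simp
next
  case False
  then have dd: "d \<bullet> d \<noteq> 0" by simp
  have "linear (reflection d)"
    by (rule linearI)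
      (simp_all add: reflection_def inner_add_left distrib_left add_divide_distrib
        scaleR_add_left scaleR_diff_right mult.left_commute)
  moreover have "reflection d v \<bullet> reflection d w = v \<bullet> w" for v w
  proof -
    define \<alpha> where "\<alpha> = 2 * (v \<bullet> d) / (d \<bullet> d)"
    define \<beta> where "\<beta> = 2 * (w \<bullet> d) / (d \<bullet> d)"
    have "\<alpha> * (d \<bullet> d) = 2 * (v \<bullet> d)" "\<beta> * (d \<bullet> d) = 2 * (w \<bullet> d)"
      using dd by (auto simp: \<alpha>_def \<beta>_def)
    then have "\<alpha> * \<beta> * (d \<bullet> d) = \<alpha> * (w \<bullet> d) + \<beta> * (v \<bullet> d)"
      by algebra
    moreover have "reflection d v \<bullet> reflection d w
        = v \<bullet> w - \<beta> * (v \<bullet> d) - \<alpha> * (w \<bullet> d) + \<alpha> * \<beta> * (d \<bullet> d)"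
      unfolding reflection_def \<alpha>_def[symmetric] \<beta>_def[symmetric]
      by (simp add: inner_diff_left inner_diff_right inner_commute algebra_simps)
    ultimately show ?thesis by simp
  qed
  ultimately show ?thesis by (simp add: orthogonal_transformation_def)
qed

text \<open>Equal norms make the coefficient in the reflection equal to 1. This turns a basis vector
  into a given unit normal; the images of the other basis vectors then form an orthonormal tangent
  basis.\<close>

lemma reflection_swap:
  assumes "norm x = norm y"
  shows "reflection (x - y) x = y"
proof (cases "x = y")
  case False
  then have "(x - y) \<bullet> (x - y) \<noteq> 0" by simp
  moreover have "(x - y) \<bullet> (x - y) = 2 * (x \<bullet> (x - y))"
    using assms by (simp add: norm_eq algebra_simps inner_commute)
  ultimately show ?thesis by (simp add: reflection_def)
qed (simp add: reflection_def)

text \<open>Expand each inner product in the orthonormal basis \<open>T c\<close> and swap the two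
  sums. The result converts a coordinate trace into one over a basis adapted to a tangent
  space.\<close>

lemma trace_orthogonal_transformation:
  fixes M T :: "'a::euclidean_space \<Rightarrow> 'a"
  assumes M: "linear M" and T: "orthogonal_transformation T"
  shows "(\<Sum>b\<in>Basis. M (T b) \<bullet> T b) = (\<Sum>b\<in>Basis. M b \<bullet> b)"
proof -
  have lT: "linear T" and iT: "\<And>v w. T v \<bullet> T w = v \<bullet> w"
    using T unfolding orthogonal_transformation_def by auto
  obtain T' where T': "\<And>v. T (T' v) = v"
    using orthogonal_transformation_surj[OF T] by (metis surjD)
  have expand: "x \<bullet> y = (\<Sum>c\<in>Basis. (x \<bullet> T c) * (y \<bullet> T c))" for x y
  proof -
    have "x \<bullet> T c = T' x \<bullet> c" for x c using iT[of "T' x" c] by (simp add: T')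
    moreover have "x \<bullet> y = T' x \<bullet> T' y" using iT[of "T' x" "T' y"] by (simp add: T')
    ultimately show ?thesis using euclidean_inner[of "T' x" "T' y"] by simp
  qed
  have M_expand: "M v = (\<Sum>b\<in>Basis. (b \<bullet> v) *\<^sub>R M b)" for v
  proof -
    have "M v = M (\<Sum>b\<in>Basis. (v \<bullet> b) *\<^sub>R b)" by (simp only: euclidean_representation)
    then show ?thesis by (simp only: linear_sum[OF M] linear_scale[OF M] inner_commute)
  qed
  have "(\<Sum>b\<in>Basis. M b \<bullet> b) = (\<Sum>b\<in>Basis. \<Sum>c\<in>Basis. (M b \<bullet> T c) * (b \<bullet> T c))"
    by (intro sum.cong refl expand)
  also have "\<dots> = (\<Sum>c\<in>Basis. (\<Sum>b\<in>Basis. (b \<bullet> T c) *\<^sub>R M b) \<bullet> T c)"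
    by (subst sum.swap) (simp only: inner_sum_left inner_scaleR_left mult.commute)
  also have "\<dots> = (\<Sum>c\<in>Basis. M (T c) \<bullet> T c)"
    by (simp only: M_expand[symmetric])
  finally show ?thesis by simp
qed

text \<open>Testing on the part of \<open>P\<close> orthogonal to \<open>\<nu>\<close> shows that
  this part vanishes. Turns a vanishing first variation into normality.\<close>

lemma orthogonal_complement_line:
  fixes P \<nu> :: "'a::real_inner"
  assumes "norm \<nu> = 1" and "\<And>e. e \<bullet> \<nu> = 0 \<Longrightarrow> P \<bullet> e = 0"
  shows "P = (P \<bullet> \<nu>) *\<^sub>R \<nu>"
proof -
  have \<nu>: "\<nu> \<bullet> \<nu> = 1" using assms(1) by (simp add: norm_eq_1)
  let ?e = "P - (P \<bullet> \<nu>) *\<^sub>R \<nu>"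
  have o: "?e \<bullet> \<nu> = 0" by (simp add: algebra_simps \<nu>)
  then have "P \<bullet> ?e = 0" by (rule assms(2))
  with o have "?e \<bullet> ?e = 0" by (simp add: inner_diff_right inner_diff_left inner_commute algebra_simps \<nu>)
  then show ?thesis by simp
qed

section \<open>Curves in level sets\<close>

lemma Ck_has_derivative_grad:
  assumes "Ck (Suc k) U u" "x \<in> U"
  shows "(u has_derivative (\<lambda>h. grad u x \<bullet> h)) (at x)"
proof -
  have d: "(u has_derivative frechet_derivative u (at x)) (at x)"
    using assms frechet_derivative_works by auto
  have lin: "linear (frechet_derivative u (at x))"
    using d has_derivative_linear by blast
  have "frechet_derivative u (at x) h = grad u x \<bullet> h" for h
  proof -
    have "frechet_derivative u (at x) h
        = frechet_derivative u (at x) (\<Sum>b\<in>Basis. (h \<bullet> b) *\<^sub>R b)"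
      by (simp add: euclidean_representation)
    also have "\<dots> = (\<Sum>b\<in>Basis. (h \<bullet> b) * frechet_derivative u (at x) b)"
      by (simp add: linear_sum[OF lin] linear_scale[OF lin])
    also have "\<dots> = grad u x \<bullet> h"
      by (simp add: grad_def inner_sum_left inner_commute[of h] mult.commute)
    finally show ?thesis .
  qed
  then show ?thesis using d by (metis (no_types, lifting) ext)
qed

lemma Ck2_grad_differentiable:
  assumes "Ck 2 U u" "x \<in> U"
  obtains M where "(grad u has_derivative M) (at x)"
proof -
  have "(\<lambda>y. grad u y \<bullet> b) differentiable (at x)" if "b \<in> Basis" for b
  proof -
    have "(\<lambda>y. grad u y \<bullet> b) = (\<lambda>y. frechet_derivative u (at y) b)"
      using that by (simp add: grad_def)
    then show ?thesis using assms that by (auto simp: numeral_2_eq_2)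
  qed
  then have "grad u differentiable (at x)"
    using differentiable_componentwise_within[of "grad u" x UNIV] by simp
  then show thesis using that unfolding differentiable_def by blast
qed

text \<open>\<open>h'\<close> is zero at 0 with positive slope, hence positive just to the right,
  where \<open>h\<close> therefore grows from 0. Differentiability of \<open>h'\<close> is required
  at 0 only.\<close>

lemma eventually_pos_of_second_derivative:
  fixes h h' :: "real \<Rightarrow> real"
  assumes "h 0 = 0" "h' 0 = 0" and h: "\<forall>\<^sub>F s in at 0. (h has_real_derivative h' s) (at s)"
    and h0: "(h has_real_derivative h' 0) (at 0)"
    and h': "(h' has_real_derivative l) (at 0)" and "l > 0"
  shows "\<forall>\<^sub>F s in at_right 0. h s > 0"
proof -
  obtain d1 where d1: "d1 > 0" "\<And>s. 0 < s \<Longrightarrow> s < d1 \<Longrightarrow> h' s > 0"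
    using DERIV_pos_inc_right[OF h' \<open>l > 0\<close>] assms(2) by auto
  obtain d2 where d2: "d2 > 0" "\<And>s. s \<noteq> 0 \<Longrightarrow> \<bar>s\<bar> < d2 \<Longrightarrow> (h has_real_derivative h' s) (at s)"
    using h unfolding eventually_at by (auto simp: dist_real_def)
  have "h s > 0" if s: "0 < s" "s < min d1 d2" for s
  proof -
    have "h 0 < h s"
    proof (rule DERIV_pos_imp_increasing_open[OF s(1)])
      fix x assume "0 < x" "x < s"
      then show "\<exists>y. DERIV h x :> y \<and> y > 0"
        using s d1(2)[of x] d2(2)[of x] by (intro exI[of _ "h' x"]) auto
    next
      show "continuous_on {0..s} h"
      proof (rule DERIV_continuous_on)
        fix x assume "x \<in> {0..s}"
        then show "(h has_real_derivative h' x) (at x within {0..s})"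
          using s d2(2)[of x] h0 by (cases "x = 0") (auto intro: has_field_derivative_at_within)
      qed
    qed
    then show ?thesis using assms(1) by simp
  qed
  then show ?thesis
    unfolding eventually_at_right_field using d1(1) d2(1) by (intro exI[of _ "min d1 d2"]) auto
qed

text \<open>At \<open>s = 0\<close> the first derivative of \<open>u\<close> along the parabola is
  \<open>g p \<bullet> e = 0\<close>, and the second is the quantity assumed positive, with
  \<open>M\<close> the Hessian.\<close>

lemma eventually_pos_along_parabola:
  fixes u :: "'a::euclidean_space \<Rightarrow> real"
  assumes U: "open U" "p \<in> U" and der: "\<And>x. x \<in> U \<Longrightarrow> (u has_derivative (\<lambda>h. g x \<bullet> h)) (at x)"
    and M: "(g has_derivative M) (at p)" and "u p = 0" and e: "g p \<bullet> e = 0"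
    and pos: "M e \<bullet> e + 2 * (g p \<bullet> w) > 0"
  shows "\<forall>\<^sub>F s in at_right 0. u (p + s *\<^sub>R e + s\<^sup>2 *\<^sub>R w) > 0"
proof -
  define \<gamma> where "\<gamma> s = p + s *\<^sub>R e + s\<^sup>2 *\<^sub>R w" for s :: real
  define \<gamma>' where "\<gamma>' s = e + (2 * s) *\<^sub>R w" for s :: real
  have \<gamma>: "(\<gamma> has_derivative (\<lambda>h. h *\<^sub>R \<gamma>' s)) (at s)" for s
    unfolding \<gamma>_def \<gamma>'_def by (auto intro!: derivative_eq_intros simp: algebra_simps)
  have \<gamma>': "(\<gamma>' has_derivative (\<lambda>h. h *\<^sub>R (2 *\<^sub>R w))) (at s)" for s
    unfolding \<gamma>'_def by (auto intro!: derivative_eq_intros simp: algebra_simps)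
  have \<gamma>0: "\<gamma> 0 = p" "\<gamma>' 0 = e" by (auto simp: \<gamma>_def \<gamma>'_def)
  define h' where "h' s = g (\<gamma> s) \<bullet> \<gamma>' s" for s
  have hder: "((\<lambda>s. u (\<gamma> s)) has_real_derivative h' s) (at s)" if "\<gamma> s \<in> U" for s
    using has_derivative_compose[OF \<gamma> der[OF that]]
    by (simp add: has_field_derivative_def h'_def mult.commute[of _ "g (\<gamma> s) \<bullet> \<gamma>' s"])
  have "\<forall>\<^sub>F s in at 0. \<gamma> s \<in> U"
    using has_derivative_continuous[OF \<gamma>[of 0]] U \<gamma>0
    unfolding continuous_at by (auto intro: topological_tendstoD)
  then have ev: "\<forall>\<^sub>F s in at 0. ((\<lambda>s. u (\<gamma> s)) has_real_derivative h' s) (at s)"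
    by (auto elim: eventually_mono intro: hder)
  have "(g has_derivative M) (at (\<gamma> 0))" using M \<gamma>0 by simp
  then have "((\<lambda>s. g (\<gamma> s)) has_derivative (\<lambda>h. M (h *\<^sub>R e))) (at 0)"
    using has_derivative_compose[OF \<gamma>[of 0]] \<gamma>0 by simp
  then have "(h' has_derivative (\<lambda>h. g p \<bullet> (h *\<^sub>R (2 *\<^sub>R w)) + M (h *\<^sub>R e) \<bullet> e)) (at 0)"
    unfolding h'_def using has_derivative_inner[OF _ \<gamma>'[of 0]] \<gamma>0 by fastforce
  moreover have "(\<lambda>h. g p \<bullet> (h *\<^sub>R (2 *\<^sub>R w)) + M (h *\<^sub>R e) \<bullet> e) = (*) (M e \<bullet> e + 2 * (g p \<bullet> w))"
    using linear_scale[OF has_derivative_linear[OF M]] by (auto simp: algebra_simps)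
  ultimately have "(h' has_real_derivative (M e \<bullet> e + 2 * (g p \<bullet> w))) (at 0)"
    by (simp add: has_field_derivative_def)
  from eventually_pos_of_second_derivative[OF _ _ ev hder this pos]
  show ?thesis using assms(2,5) e \<gamma>0 by (simp add: h'_def) (simp add: \<gamma>_def)
qed

text \<open>In place of an implicit function, parabolas with half acceleration
  \<open>k *\<^sub>R \<nu>\<close> are compared: for \<open>k\<close> slightly above the critical
  value \<open>u\<close> becomes positive, slightly below negative, so for each small
  \<open>s\<close> the intermediate value theorem in \<open>k\<close> finds a point of the level
  set.\<close>

lemma level_set_admits_curve:
  fixes u :: "'a::euclidean_space \<Rightarrow> real"
  assumes U: "open U" "p \<in> U" and S: "closed S" "S \<inter> U = {x \<in> U. u x = 0}" and "p \<in> S"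
    and der: "\<And>x. x \<in> U \<Longrightarrow> (u has_derivative (\<lambda>h. g x \<bullet> h)) (at x)"
    and M: "(g has_derivative M) (at p)" and e: "g p \<bullet> e = 0"
    and \<nu>: "g p \<bullet> \<nu> > 0"
  shows "admits_curve S p e (- (M e \<bullet> e / (2 * (g p \<bullet> \<nu>))) *\<^sub>R \<nu>)"
proof -
  \<comment> \<open>The value of \<open>k\<close> for which the second derivative of
    \<open>u\<close> along the parabola vanishes.\<close>
  define \<kappa> where "\<kappa> = - (M e \<bullet> e / (2 * (g p \<bullet> \<nu>)))"
  have up: "u p = 0" using U S \<open>p \<in> S\<close> by blast
  define \<gamma> where "\<gamma> k s = p + s *\<^sub>R e + s\<^sup>2 *\<^sub>R (k *\<^sub>R \<nu>)" for k s :: real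
  define K where "K s = {k. \<gamma> k s \<in> S}" for s
  have closedK: "closed (K s)" for s
  proof -
    have "K s = \<gamma>' -` S" if "\<gamma>' = (\<lambda>k. \<gamma> k s)" for \<gamma>' using that by (auto simp: K_def)
    moreover have "continuous_on UNIV (\<lambda>k. \<gamma> k s)"
      unfolding \<gamma>_def by (intro continuous_intros)
    ultimately show ?thesis using continuous_closed_vimage[of S "\<lambda>k. \<gamma> k s"] S(1)
      by (simp add: continuous_on_eq_continuous_at)
  qed
  have near: "\<forall>\<^sub>F s in at_right 0. \<exists>k\<in>K s. \<bar>k - \<kappa>\<bar> \<le> \<delta>" if "\<delta> > 0" for \<delta>
  proof -
    have "M e \<bullet> e = - (2 * \<kappa>) * (g p \<bullet> \<nu>)" using \<nu> by (simp add: \<kappa>_def)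
    then have Me: "M e \<bullet> e + 2 * (g p \<bullet> (k *\<^sub>R \<nu>)) = 2 * (k - \<kappa>) * (g p \<bullet> \<nu>)" for k
      by (simp add: algebra_simps)
    have pos: "\<forall>\<^sub>F s in at_right 0. u (\<gamma> (\<kappa> + \<delta>) s) > 0"
      unfolding \<gamma>_def
      by (rule eventually_pos_along_parabola[OF U der M up e]) (use Me \<nu> that in auto)
    have "\<forall>\<^sub>F s in at_right 0. - u (\<gamma> (\<kappa> - \<delta>) s) > 0"
      unfolding \<gamma>_def
    proof (rule eventually_pos_along_parabola[OF U, of _ "\<lambda>x. - g x" "\<lambda>h. - M h"])
      show "((\<lambda>x. - u x) has_derivative (\<lambda>h. - g x \<bullet> h)) (at x)" if "x \<in> U" for x
        using has_derivative_minus[OF der[OF that]] by simp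
      show "((\<lambda>x. - g x) has_derivative (\<lambda>h. - M h)) (at p)"
        by (rule has_derivative_minus[OF M])
      show "0 < - M e \<bullet> e + 2 * (- g p \<bullet> ((\<kappa> - \<delta>) *\<^sub>R \<nu>))"
        using Me[of "\<kappa> - \<delta>"] mult_pos_pos[OF that \<nu>] by simp
    qed (use up e in auto)
    \<comment> \<open>All parabola points with \<open>k\<close> within \<open>\<delta>\<close> of
      \<open>\<kappa>\<close> must stay in \<open>U\<close>, because only there is a zero of
      \<open>u\<close> known to lie in \<open>S\<close>.\<close>
    moreover obtain r where r: "r > 0" "ball p r \<subseteq> U"
      using U openE by blast
    have "((\<lambda>s. s * norm e + s\<^sup>2 * ((\<bar>\<kappa>\<bar> + \<delta>) * norm \<nu>)) \<longlongrightarrow>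
        0 * norm e + 0\<^sup>2 * ((\<bar>\<kappa>\<bar> + \<delta>) * norm \<nu>)) (at_right 0)"
      by (intro tendsto_intros)
    then have "\<forall>\<^sub>F s in at_right 0. s * norm e + s\<^sup>2 * ((\<bar>\<kappa>\<bar> + \<delta>) * norm \<nu>) < r"
      using r(1) by (auto dest: order_tendstoD)
    ultimately show ?thesis using pos eventually_at_right_less[of 0]
    proof eventually_elim
      case (elim s)
      have inU: "\<gamma> k s \<in> U" if "k \<in> {\<kappa> - \<delta>..\<kappa> + \<delta>}" for k
      proof -
        have "norm (s *\<^sub>R e + s\<^sup>2 *\<^sub>R (k *\<^sub>R \<nu>)) \<le> s * norm e + s\<^sup>2 * (\<bar>k\<bar> * norm \<nu>)"
          using elim by (intro order_trans[OF norm_triangle_ineq]) (auto simp: abs_mult)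
        also have "\<dots> \<le> s * norm e + s\<^sup>2 * ((\<bar>\<kappa>\<bar> + \<delta>) * norm \<nu>)"
          using that \<open>\<delta> > 0\<close> by (intro add_mono mult_left_mono mult_right_mono) auto
        finally have "norm (s *\<^sub>R e + s\<^sup>2 *\<^sub>R (k *\<^sub>R \<nu>)) < r" using elim by simp
        moreover have "\<gamma> k s - p = s *\<^sub>R e + s\<^sup>2 *\<^sub>R (k *\<^sub>R \<nu>)" by (simp add: \<gamma>_def)
        ultimately have "\<gamma> k s \<in> ball p r" by (metis dist_commute dist_norm mem_ball)
        with r show ?thesis by blast
      qed
      have "continuous_on {\<kappa> - \<delta>..\<kappa> + \<delta>} (\<lambda>k. u (\<gamma> k s))"
      proof (rule continuous_on_compose2[of U u])
        show "continuous_on U u"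
          using der has_derivative_continuous continuous_at_imp_continuous_on by blast
        show "continuous_on {\<kappa> - \<delta>..\<kappa> + \<delta>} (\<lambda>k. \<gamma> k s)"
          unfolding \<gamma>_def by (intro continuous_intros)
      qed (use inU in auto)
      then obtain k where k: "\<kappa> - \<delta> \<le> k" "k \<le> \<kappa> + \<delta>" "u (\<gamma> k s) = 0"
        using IVT'[of "\<lambda>k. u (\<gamma> k s)" "\<kappa> - \<delta>" 0 "\<kappa> + \<delta>"] elim \<open>\<delta> > 0\<close> by auto
      then have "k \<in> K s" using inU[of k] S(2) by (auto simp: K_def)
      with k show ?case by (intro bexI[of _ k]) auto
    qed
  qed
  \<comment> \<open>The intermediate value theorem gives one \<open>k\<close> for each tolerance \<open>\<delta>\<close>; the closest point
    selects a single function that works for all of them.\<close>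
  define k where "k s = closest_point (K s) \<kappa>" for s
  have "(k \<longlongrightarrow> \<kappa>) (at_right 0)"
  proof (rule tendstoI)
    fix \<epsilon> :: real assume "\<epsilon> > 0"
    then have "\<forall>\<^sub>F s in at_right 0. \<exists>k\<in>K s. \<bar>k - \<kappa>\<bar> \<le> \<epsilon> / 2" by (intro near) simp
    then show "\<forall>\<^sub>F s in at_right 0. dist (k s) \<kappa> < \<epsilon>"
    proof eventually_elim
      case (elim s)
      then obtain j where "j \<in> K s" "\<bar>j - \<kappa>\<bar> \<le> \<epsilon> / 2" by blast
      then show ?case
        using closest_point_le[OF closedK, of j s \<kappa>] \<open>\<epsilon> > 0\<close>
        unfolding k_def dist_real_def by linarith
    qed
  qed
  then have "((\<lambda>s. k s *\<^sub>R \<nu>) \<longlongrightarrow> \<kappa> *\<^sub>R \<nu>) (at_right 0)" by (intro tendsto_intros)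
  then have "expands2 (\<lambda>s. \<gamma> (k s) s) p e (\<kappa> *\<^sub>R \<nu>)"
    unfolding expands2_def \<gamma>_def by (intro exI[of _ "\<lambda>s. k s *\<^sub>R \<nu>"]) auto
  moreover have "\<forall>\<^sub>F s in at_right 0. \<gamma> (k s) s \<in> S"
    using near[of 1]
  proof (rule eventually_mono)
    fix s assume "\<exists>k\<in>K s. \<bar>k - \<kappa>\<bar> \<le> 1"
    then have "closest_point (K s) \<kappa> \<in> K s"
      using closedK by (intro closest_point_in_set) auto
    then show "\<gamma> (k s) s \<in> S" by (simp add: K_def k_def)
  qed simp
  ultimately show ?thesis unfolding admits_curve_def \<kappa>_def[symmetric] by blast
qed

section \<open>Shrinkers\<close>

text \<open>Differentiating the factor 1 / |grad u| removes the normal entry of the Hessian, so its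
  trace over the tangent hyperplane remains.\<close>

lemma divergence_unit_normal:
  fixes u :: "'a::euclidean_space \<Rightarrow> real"
  assumes M: "(grad u has_derivative M) (at p)" and g: "grad u p \<noteq> 0"
  shows "divergence (unit_normal u) p
    = ((\<Sum>b\<in>Basis. M b \<bullet> b) - M (unit_normal u p) \<bullet> unit_normal u p) / norm (grad u p)"
proof -
  define G where "G = norm (grad u p)"
  have G: "G > 0" using g by (simp add: G_def)
  define D where "D h = (1 / G) *\<^sub>R M h + (- (M h \<bullet> grad u p) / G ^ 3) *\<^sub>R grad u p" for h
  have "((\<lambda>y. norm (grad u y)) has_derivative (\<lambda>h. (M h \<bullet> grad u p) / G)) (at p)"
  proof -
    have "((\<lambda>y. norm (grad u y)) has_derivative (\<lambda>h. M h \<bullet> sgn (grad u p))) (at p)"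
      by (rule has_derivative_compose[OF M has_derivative_norm[OF g]])
    then show ?thesis by (simp add: sgn_div_norm G_def divide_inverse mult.commute)
  qed
  then have "((\<lambda>y. 1 / norm (grad u y)) has_derivative (\<lambda>h. - (M h \<bullet> grad u p) / G ^ 3)) (at p)"
    by (rule has_derivative_eq_rhs[OF has_derivative_divide[OF has_derivative_const]])
      (use G in \<open>simp_all add: G_def[symmetric] power3_eq_cube divide_inverse mult_ac\<close>)
  from has_derivative_scaleR[OF this M] have "(unit_normal u has_derivative D) (at p)"
    unfolding unit_normal_def D_def G_def .
  then have comp: "frechet_derivative (\<lambda>y. unit_normal u y \<bullet> b) (at p) b = D b \<bullet> b" for b
    by (simp add: frechet_derivative_at[OF has_derivative_inner_left, symmetric])
  have lM: "linear M" using M has_derivative_linear by blast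
  have "M (grad u p) = (\<Sum>b\<in>Basis. (grad u p \<bullet> b) *\<^sub>R M b)"
  proof -
    have "M (grad u p) = M (\<Sum>b\<in>Basis. (grad u p \<bullet> b) *\<^sub>R b)"
      by (simp only: euclidean_representation)
    then show ?thesis by (simp only: linear_sum[OF lM] linear_scale[OF lM])
  qed
  then have Mg: "M (grad u p) \<bullet> grad u p = (\<Sum>b\<in>Basis. (M b \<bullet> grad u p) * (grad u p \<bullet> b))"
    by (simp add: inner_sum_left mult.commute)
  have "divergence (unit_normal u) p = (\<Sum>b\<in>Basis. (M b \<bullet> b) / G
      - (M b \<bullet> grad u p) * (grad u p \<bullet> b) / G ^ 3)"
    unfolding divergence_def comp by (simp add: D_def inner_diff_left)
  also have "\<dots> = (\<Sum>b\<in>Basis. M b \<bullet> b) / G - M (grad u p) \<bullet> grad u p / G ^ 3"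
    by (simp add: sum_subtractf sum_divide_distrib Mg)
  also have "\<dots> = ((\<Sum>b\<in>Basis. M b \<bullet> b) - M (unit_normal u p) \<bullet> unit_normal u p) / G"
    unfolding unit_normal_def G_def[symmetric] linear_scale[OF lM]
    by (simp add: diff_divide_distrib power3_eq_cube)
  finally show ?thesis unfolding G_def .
qed

lemma shrinker_closed: "shrinker S \<Longrightarrow> closed S"
  by (simp add: shrinker_def properly_embedded_hypersurface_def)

lemma shrinker_nonempty: "shrinker S \<Longrightarrow> S \<noteq> {}"
  by (simp add: shrinker_def properly_embedded_hypersurface_def)

text \<open>\<open>\<kappa> e\<close> is half of the normal curvature in the direction \<open>e\<close>; the last conclusion is the
  shrinker equation, as the trace of the second fundamental form over a tangent basis.\<close>

lemma shrinker_curves: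
  fixes S :: "'a::euclidean_space set"
  assumes "shrinker S" "p \<in> S"
  obtains \<nu> \<kappa> where "norm \<nu> = 1"
    and "\<And>e. e \<bullet> \<nu> = 0 \<Longrightarrow> admits_curve S p e (\<kappa> e *\<^sub>R \<nu>)"
    and "\<And>(T :: 'a \<Rightarrow> 'a) b0. orthogonal_transformation T \<Longrightarrow> b0 \<in> Basis \<Longrightarrow> T b0 = \<nu> \<or> T b0 = - \<nu> \<Longrightarrow>
           (\<Sum>b\<in>Basis - {b0}. \<kappa> (T b)) = - (p \<bullet> \<nu>) / 4"
proof -
  obtain U u where pU: "p \<in> U" and loc: "local_defining_function S U u"
    using assms unfolding shrinker_def properly_embedded_hypersurface_def by blast
  define \<nu> where "\<nu> = unit_normal u p"
  define G where "G = norm (grad u p)"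
  have U: "open U" and sm: "smooth_on U u" and g: "grad u p \<noteq> 0"
    and SU: "S \<inter> U = {x \<in> U. u x = 0}"
    using loc pU unfolding local_defining_function_def by auto
  have G: "G > 0" using g by (simp add: G_def)
  have n1: "norm \<nu> = 1" using g by (simp add: \<nu>_def unit_normal_def)
  have g\<nu>: "grad u p = G *\<^sub>R \<nu>" using g by (simp add: \<nu>_def unit_normal_def G_def)
  have ip: "grad u p \<bullet> \<nu> = G" using n1 by (simp add: g\<nu> norm_eq_1)
  have ck: "Ck k U u" for k using sm by (simp add: smooth_on_def)
  obtain M where M: "(grad u has_derivative M) (at p)"
    using Ck2_grad_differentiable[OF ck pU] .
  have lM: "linear M" using M has_derivative_linear by blast
  define \<kappa> where "\<kappa> e = - (M e \<bullet> e / (2 * G))" for e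
  have curves: "admits_curve S p e (\<kappa> e *\<^sub>R \<nu>)" if "e \<bullet> \<nu> = 0" for e
    unfolding \<kappa>_def ip[symmetric]
    by (rule level_set_admits_curve[OF U pU shrinker_closed[OF assms(1)] SU assms(2)
          Ck_has_derivative_grad[OF ck[of "Suc 0"]] M])
      (use that ip G in \<open>auto simp: g\<nu> inner_commute\<close>)
  have "mean_curvature_vector u p = - (1/2) *\<^sub>R ((p \<bullet> \<nu>) *\<^sub>R \<nu>)"
    using assms pU loc unfolding shrinker_def \<nu>_def by blast
  then have "(divergence (unit_normal u) p - (p \<bullet> \<nu>) / 2) *\<^sub>R \<nu> = 0"
    unfolding mean_curvature_vector_def \<nu>_def[symmetric] by (simp add: algebra_simps)
  then have "divergence (unit_normal u) p = (p \<bullet> \<nu>) / 2"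
    using n1 by auto
  then have tr: "(\<Sum>b\<in>Basis. M b \<bullet> b) - M \<nu> \<bullet> \<nu> = G * (p \<bullet> \<nu>) / 2"
    using divergence_unit_normal[OF M g] G unfolding \<nu>_def[symmetric] G_def[symmetric]
    by (simp add: field_simps)
  \<comment> \<open>The factor 1/4 combines the 1/2 of the shrinker equation with the 1/2 in
    \<open>\<kappa>\<close>. Either sign of \<open>T b0\<close> is allowed since
    \<open>M v \<bullet> v\<close> is even in \<open>v\<close>.\<close>
  have "(\<Sum>b\<in>Basis - {b0}. \<kappa> (T b)) = - (p \<bullet> \<nu>) / 4"
    if T: "orthogonal_transformation T" "b0 \<in> Basis" "T b0 = \<nu> \<or> T b0 = - \<nu>" for T :: "'a \<Rightarrow> 'a" and b0
  proof -
    have "M (T b0) \<bullet> T b0 = M \<nu> \<bullet> \<nu>"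
      using T(3) linear_neg[OF lM] by auto
    then have "(\<Sum>b\<in>Basis - {b0}. M (T b) \<bullet> T b) = G * (p \<bullet> \<nu>) / 2"
      using tr trace_orthogonal_transformation[OF lM T(1)]
      by (simp add: sum_diff1 T(2))
    then show ?thesis
      using G by (simp add: \<kappa>_def sum_negf sum_divide_distrib[symmetric] field_simps)
  qed
  with n1 curves show thesis by (rule that)
qed

text \<open>At the point \<open>p\<close> of \<open>S\<close> closest to the origin,
  \<open>p\<close> is normal to \<open>S\<close>. The second variation of the squared norm, summed
  over a tangent basis, becomes n - |p|^2 / 2 by the shrinker equation, with n the dimension of
  \<open>S\<close>.\<close>

lemma shrinker_meets_ball:
  fixes S :: "'a::euclidean_space set"
  assumes "shrinker S"
  obtains p where "p \<in> S" "p \<bullet> p \<le> 2 * real (DIM('a) - 1)"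
proof -
  obtain p where p: "p \<in> S" "\<And>x. x \<in> S \<Longrightarrow> dist 0 p \<le> dist 0 x"
    using distance_attains_inf[OF shrinker_closed[OF assms] shrinker_nonempty[OF assms]] by metis
  obtain \<nu> \<kappa> where \<nu>: "norm \<nu> = 1"
    and curves: "\<And>e. e \<bullet> \<nu> = 0 \<Longrightarrow> admits_curve S p e (\<kappa> e *\<^sub>R \<nu>)"
    and trace: "\<And>(T :: 'a \<Rightarrow> 'a) b0. orthogonal_transformation T \<Longrightarrow> b0 \<in> Basis \<Longrightarrow>
        T b0 = \<nu> \<or> T b0 = - \<nu> \<Longrightarrow> (\<Sum>b\<in>Basis - {b0}. \<kappa> (T b)) = - (p \<bullet> \<nu>) / 4"
    using shrinker_curves[OF assms p(1)] by metis
  have var: "p \<bullet> e \<ge> 0 \<and> (p \<bullet> e = 0 \<longrightarrow> e \<bullet> e + 2 * \<kappa> e * (p \<bullet> \<nu>) \<ge> 0)" if e: "e \<bullet> \<nu> = 0" for e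
  proof -
    obtain \<gamma> where \<gamma>: "expands2 \<gamma> p e (\<kappa> e *\<^sub>R \<nu>)" "\<forall>\<^sub>F s in at_right 0. \<gamma> s \<in> S"
      using curves[OF e] unfolding admits_curve_def by blast
    have ex: "expands2 (\<lambda>s. \<gamma> s \<bullet> \<gamma> s - p \<bullet> p) 0 (2 * (p \<bullet> e)) (e \<bullet> e + 2 * \<kappa> e * (p \<bullet> \<nu>))"
      using expands2_diff[OF expands2_inner[OF \<gamma>(1) \<gamma>(1)] expands2_const[of "p \<bullet> p"]]
      by (simp add: inner_commute add.commute mult.assoc)
    have nonneg: "\<forall>\<^sub>F s in at_right 0. \<gamma> s \<bullet> \<gamma> s - p \<bullet> p \<ge> 0"
      using \<gamma>(2) by (rule eventually_mono) (use p(2) in \<open>simp add: norm_le\<close>)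
    from expands2_nonneg_first[OF ex nonneg] expands2_nonneg_second[OF _ nonneg] ex
    show ?thesis by auto
  qed
  have tan: "p \<bullet> e = 0" if "e \<bullet> \<nu> = 0" for e
    using var[of e] var[of "- e"] that by simp
  have p\<nu>: "p = (p \<bullet> \<nu>) *\<^sub>R \<nu>"
    by (rule orthogonal_complement_line[OF \<nu> tan])
  obtain b0 :: 'a where b0: "b0 \<in> Basis" using nonempty_Basis by blast
  define T where "T = reflection (b0 - \<nu>)"
  have T: "orthogonal_transformation T" "T b0 = \<nu>"
    using b0 \<nu> by (auto simp: T_def orthogonal_transformation_reflection reflection_swap)
  have "0 \<le> (\<Sum>b\<in>Basis - {b0}. 1 + 2 * (p \<bullet> \<nu>) * \<kappa> (T b))"
  proof (rule sum_nonneg)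
    fix b assume b: "b \<in> Basis - {b0}"
    have iT: "T v \<bullet> T w = v \<bullet> w" for v w using T(1) by (simp add: orthogonal_transformation_def)
    have "T b \<bullet> \<nu> = 0" "T b \<bullet> T b = 1"
      using iT[of b b0] iT[of b b] b b0 by (auto simp: T(2) inner_Basis)
    with var tan show "0 \<le> 1 + 2 * (p \<bullet> \<nu>) * \<kappa> (T b)" by (metis mult.assoc mult.commute)
  qed
  also have "\<dots> = real (DIM('a) - 1) - (p \<bullet> \<nu>) * (p \<bullet> \<nu>) / 2"
    using trace[OF T(1) b0] b0 T(2)
    by (simp add: sum.distrib sum_distrib_left[symmetric] card_Diff_singleton)
  also have "(p \<bullet> \<nu>) * (p \<bullet> \<nu>) = p \<bullet> p"
    by (subst (3) p\<nu>) simp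
  finally show thesis using that p(1) by simp
qed

section \<open>The two-point function\<close>

text \<open>Along the two curves \<open>F\<close> starts at 0 and is nonnegative for small
  \<open>s > 0\<close>, which fixes the signs of its leading coefficients. \<open>P\<close> and
  \<open>Q\<close> are half of the gradients in \<open>x\<close> and \<open>y\<close> of the
  difference of the two sides of \<open>bound\<close>.\<close>

lemma two_point_variation:
  fixes x y e f w z :: "'a::real_inner" and c \<rho> :: real
  assumes "admits_curve S0 x e w" "admits_curve S1 y f z"
    and bound: "\<And>x y. x \<in> S0 \<Longrightarrow> y \<in> S1 \<Longrightarrow> x \<bullet> x < \<rho> \<Longrightarrow> y \<bullet> y < \<rho> \<Longrightarrow>
      c * ((\<rho> - x \<bullet> x) * (\<rho> - y \<bullet> y)) \<le> (x - y) \<bullet> (x - y)"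
    and a: "a = \<rho> - x \<bullet> x" "a > 0" and b: "b = \<rho> - y \<bullet> y" "b > 0"
    and eq: "(x - y) \<bullet> (x - y) = c * (a * b)"
    and P: "P = (1 + c * b) *\<^sub>R x - y" and Q: "Q = (1 + c * a) *\<^sub>R y - x"
  shows "P \<bullet> e + Q \<bullet> f \<ge> 0"
    and "P \<bullet> e + Q \<bullet> f = 0 \<Longrightarrow> (1 + c * b) * (e \<bullet> e) + (1 + c * a) * (f \<bullet> f) - 2 * (e \<bullet> f)
      - 4 * c * ((x \<bullet> e) * (y \<bullet> f)) + 2 * (P \<bullet> w) + 2 * (Q \<bullet> z) \<ge> 0"
proof -
  obtain \<gamma> where \<gamma>: "expands2 \<gamma> x e w" "\<forall>\<^sub>F s in at_right 0. \<gamma> s \<in> S0"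
    using assms(1) unfolding admits_curve_def by blast
  obtain \<eta> where \<eta>: "expands2 \<eta> y f z" "\<forall>\<^sub>F s in at_right 0. \<eta> s \<in> S1"
    using assms(2) unfolding admits_curve_def by blast
  define F where "F s = (\<gamma> s - \<eta> s) \<bullet> (\<gamma> s - \<eta> s)
    - c * ((\<rho> - \<gamma> s \<bullet> \<gamma> s) * (\<rho> - \<eta> s \<bullet> \<eta> s))" for s
  define F2 where "F2 = (1 + c * b) * (e \<bullet> e) + (1 + c * a) * (f \<bullet> f) - 2 * (e \<bullet> f)
      - 4 * c * ((x \<bullet> e) * (y \<bullet> f)) + 2 * (P \<bullet> w) + 2 * (Q \<bullet> z)"
  note A = expands2_diff[OF expands2_const[of \<rho>] expands2_inner[OF \<gamma>(1) \<gamma>(1)]]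
  note B = expands2_diff[OF expands2_const[of \<rho>] expands2_inner[OF \<eta>(1) \<eta>(1)]]
  note D = expands2_diff[OF \<gamma>(1) \<eta>(1)]
  note F = expands2_diff[OF expands2_inner[OF D D] expands2_mult[OF expands2_const[of c] expands2_mult[OF A B]]]
  have "expands2 F 0 (2 * (P \<bullet> e + Q \<bullet> f)) F2"
  proof -
    have "(x - y) \<bullet> (x - y) - c * ((\<rho> - x \<bullet> x) * (\<rho> - y \<bullet> y)) = 0"
      using eq a b by simp
    with F show ?thesis
      unfolding F_def[symmetric] F2_def P Q a(1) b(1)
      by (simp add: inner_add_left inner_add_right inner_diff_left inner_diff_right
          inner_commute algebra_simps)
  qed
  moreover have "\<forall>\<^sub>F s in at_right 0. F s \<ge> 0"
  proof -
    have "((\<lambda>s. \<gamma> s \<bullet> \<gamma> s) \<longlongrightarrow> x \<bullet> x) (at_right 0)" "((\<lambda>s. \<eta> s \<bullet> \<eta> s) \<longlongrightarrow> y \<bullet> y) (at_right 0)"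
      using expands2_tendsto \<gamma>(1) \<eta>(1) by (intro tendsto_intros; blast)+
    \<comment> \<open>For small \<open>s\<close> both curves remain in the open ball where
      \<open>bound\<close> applies.\<close>
    then have "\<forall>\<^sub>F s in at_right 0. \<gamma> s \<bullet> \<gamma> s < \<rho>" "\<forall>\<^sub>F s in at_right 0. \<eta> s \<bullet> \<eta> s < \<rho>"
      using a b by (auto dest: order_tendstoD)
    with \<gamma>(2) \<eta>(2) show ?thesis
      by eventually_elim (use bound in \<open>simp add: F_def\<close>)
  qed
  ultimately have "2 * (P \<bullet> e + Q \<bullet> f) \<ge> 0" "P \<bullet> e + Q \<bullet> f = 0 \<Longrightarrow> F2 \<ge> 0"
    using expands2_nonneg_first[of F] expands2_nonneg_second[of F] by (blast, simp)
  then show "P \<bullet> e + Q \<bullet> f \<ge> 0" "P \<bullet> e + Q \<bullet> f = 0 \<Longrightarrow> F2 \<ge> 0"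
    by simp_all
qed

text \<open>The inner products among \<open>x\<close> and \<open>y\<close> are all determined by
  \<open>a\<close>, \<open>b\<close>, \<open>c\<close>, \<open>\<rho>\<close>. In order, the
  identities serve to show that \<open>P\<close> is nonzero, to evaluate the sum produced by the two
  shrinker equations, to match the normal lines, and to collapse the mixed second-order
  terms.\<close>

lemma two_point_identities:
  fixes x y :: "'a::real_inner" and c \<rho> :: real
  assumes "c > 0" and a: "a = \<rho> - x \<bullet> x" "a > 0" and b: "b = \<rho> - y \<bullet> y" "b > 0"
    and eq: "(x - y) \<bullet> (x - y) = c * (a * b)"
    and P: "P = (1 + c * b) *\<^sub>R x - y" and Q: "Q = (1 + c * a) *\<^sub>R y - x"
  shows "P \<bullet> P = c * b\<^sup>2 * (1 + c * \<rho>)"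
    and "x \<bullet> P + y \<bullet> Q = c * (\<rho> * (a + b) - a * b)"
    and "a *\<^sub>R reflection (x - y) P = b *\<^sub>R Q"
    and "P \<bullet> e = 0 \<Longrightarrow> e \<bullet> reflection (x - y) e
           + 2 * c * ((x \<bullet> e) * (y \<bullet> reflection (x - y) e)) = e \<bullet> e"
proof -
  define Z where "Z = x \<bullet> y"
  have X: "x \<bullet> x = \<rho> - a" and Y: "y \<bullet> y = \<rho> - b" using a b by auto
  have XY: "x \<bullet> y = Z" "y \<bullet> x = Z" by (auto simp: Z_def inner_commute)
  have Z: "2 * Z = 2 * \<rho> - a - b - c * a * b"
    using eq by (simp add: inner_diff_left inner_diff_right X Y XY algebra_simps)
  show "P \<bullet> P = c * b\<^sup>2 * (1 + c * \<rho>)"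
  proof -
    have "P \<bullet> P = (1 + c * b)\<^sup>2 * (\<rho> - a) - (1 + c * b) * (2 * Z) + (\<rho> - b)"
      by (simp add: P inner_diff_left inner_diff_right X Y XY power2_eq_square algebra_simps)
    then show ?thesis unfolding Z by (simp add: power2_eq_square algebra_simps)
  qed
  show "x \<bullet> P + y \<bullet> Q = c * (\<rho> * (a + b) - a * b)"
  proof -
    have "x \<bullet> P + y \<bullet> Q = (1 + c * b) * (\<rho> - a) + (1 + c * a) * (\<rho> - b) - 2 * Z"
      by (simp add: P Q inner_diff_right X Y XY algebra_simps)
    then show ?thesis unfolding Z by (simp add: algebra_simps)
  qed
  show "a *\<^sub>R reflection (x - y) P = b *\<^sub>R Q"
  proof -
    have "2 * (P \<bullet> (x - y)) = 2 * (1 + c * b) * (\<rho> - a) + 2 * (\<rho> - b) - (2 + c * b) * (2 * Z)"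
      by (simp add: P inner_diff_left inner_diff_right X Y XY algebra_simps)
    then have "2 * (P \<bullet> (x - y)) = c * b * (a + b + c * a * b)"
      unfolding Z by (simp add: algebra_simps)
    then have "a * (2 * (P \<bullet> (x - y)) / ((x - y) \<bullet> (x - y))) = a + b + c * a * b"
      unfolding eq using assms(1) a(2) b(2) by (simp add: field_simps)
    then have "a *\<^sub>R reflection (x - y) P = a *\<^sub>R P - (a + b + c * a * b) *\<^sub>R (x - y)"
      by (simp add: reflection_def scaleR_diff_right)
    also have "\<dots> = b *\<^sub>R Q" by (simp add: P Q algebra_simps)
    finally show ?thesis .
  qed
  assume Pe: "P \<bullet> e = 0"
  \<comment> \<open>Tangency of \<open>e\<close> fixes \<open>y \<bullet> e\<close> in terms of
    \<open>x \<bullet> e\<close>, so every correction term is expressed through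
    \<open>E\<close>.\<close>
  define E where "E = x \<bullet> e"
  have ye: "y \<bullet> e = (1 + c * b) * E" using Pe by (simp add: P E_def inner_diff_left)
  have ed: "e \<bullet> (x - y) = - (c * b * E)"
    using ye by (simp add: inner_diff_right inner_commute[of e] E_def[symmetric] algebra_simps)
  then have f: "reflection (x - y) e = e + (2 * E / a) *\<^sub>R (x - y)"
    unfolding reflection_def ed eq using assms(1) a(2) b(2) by simp
  have "e \<bullet> reflection (x - y) e = e \<bullet> e - 2 * c * b * E\<^sup>2 / a"
    unfolding f by (simp add: inner_add_right ed power2_eq_square)
  moreover have "y \<bullet> reflection (x - y) e = E * b / a"
  proof -
    have "2 * (y \<bullet> (x - y)) = b - a - c * a * b"
      using Z by (simp add: inner_diff_right Y XY)
    then have "y \<bullet> reflection (x - y) e = (1 + c * b) * E + (E / a) * (b - a - c * a * b)"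
      unfolding f by (simp add: inner_add_right ye)
    then show ?thesis using a(2) by (simp add: field_simps)
  qed
  ultimately show "e \<bullet> reflection (x - y) e
      + 2 * c * ((x \<bullet> e) * (y \<bullet> reflection (x - y) e)) = e \<bullet> e"
    by (simp add: E_def[symmetric] power2_eq_square)
qed

text \<open>With \<open>p\<close>, \<open>q\<close> the signed lengths of \<open>P\<close>,
  \<open>Q\<close> along the unit normals, summing the second variation over tangent directions
  brings in both curvature traces, and these combine to
  \<open>x \<bullet> P + y \<bullet> Q\<close>.\<close>

lemma shrinkers_no_interior_minimum:
  fixes S0 S1 :: "'a::euclidean_space set"
  assumes "shrinker S0" "shrinker S1" and "x \<in> S0" "y \<in> S1" and "c > 0"
    and \<rho>: "\<rho> > 4 * real (DIM('a) - 1)"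
    and bound: "\<And>x y. x \<in> S0 \<Longrightarrow> y \<in> S1 \<Longrightarrow> x \<bullet> x < \<rho> \<Longrightarrow> y \<bullet> y < \<rho> \<Longrightarrow>
      c * ((\<rho> - x \<bullet> x) * (\<rho> - y \<bullet> y)) \<le> (x - y) \<bullet> (x - y)"
    and a: "a = \<rho> - x \<bullet> x" "a > 0" and b: "b = \<rho> - y \<bullet> y" "b > 0"
    and eq: "(x - y) \<bullet> (x - y) = c * (a * b)"
  shows False
proof -
  define P where "P = (1 + c * b) *\<^sub>R x - y"
  define Q where "Q = (1 + c * a) *\<^sub>R y - x"
  define A where "A = reflection (x - y)"
  note var = two_point_variation[OF _ _ bound a b eq P_def Q_def]
  note ids = two_point_identities[OF \<open>c > 0\<close> a b eq P_def Q_def, folded A_def]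
  obtain \<nu>0 \<kappa>0 where \<nu>0: "norm \<nu>0 = 1"
    and curves0: "\<And>e. e \<bullet> \<nu>0 = 0 \<Longrightarrow> admits_curve S0 x e (\<kappa>0 e *\<^sub>R \<nu>0)"
    and trace0: "\<And>(T :: 'a \<Rightarrow> 'a) b0. orthogonal_transformation T \<Longrightarrow> b0 \<in> Basis \<Longrightarrow>
        T b0 = \<nu>0 \<or> T b0 = - \<nu>0 \<Longrightarrow> (\<Sum>b\<in>Basis - {b0}. \<kappa>0 (T b)) = - (x \<bullet> \<nu>0) / 4"
    using shrinker_curves[OF assms(1,3)] by metis
  obtain \<nu>1 \<kappa>1 where \<nu>1: "norm \<nu>1 = 1"
    and curves1: "\<And>e. e \<bullet> \<nu>1 = 0 \<Longrightarrow> admits_curve S1 y e (\<kappa>1 e *\<^sub>R \<nu>1)"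
    and trace1: "\<And>(T :: 'a \<Rightarrow> 'a) b0. orthogonal_transformation T \<Longrightarrow> b0 \<in> Basis \<Longrightarrow>
        T b0 = \<nu>1 \<or> T b0 = - \<nu>1 \<Longrightarrow> (\<Sum>b\<in>Basis - {b0}. \<kappa>1 (T b)) = - (y \<bullet> \<nu>1) / 4"
    using shrinker_curves[OF assms(2,4)] by metis
  \<comment> \<open>One point moves in the directions \<open>e\<close> and \<open>- e\<close> while
    the other stays fixed.\<close>
  have Pe: "P \<bullet> e = 0" if "e \<bullet> \<nu>0 = 0" for e
    using var(1)[OF curves0[of e] admits_curve_const[OF assms(4)]]
      var(1)[OF curves0[of "- e"] admits_curve_const[OF assms(4)]] that by simp
  have Qe: "Q \<bullet> e = 0" if "e \<bullet> \<nu>1 = 0" for e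
    using var(1)[OF admits_curve_const[OF assms(3)] curves1[of e]]
      var(1)[OF admits_curve_const[OF assms(3)] curves1[of "- e"]] that by simp
  define p where "p = P \<bullet> \<nu>0"
  define q where "q = Q \<bullet> \<nu>1"
  have P\<nu>: "P = p *\<^sub>R \<nu>0" unfolding p_def by (rule orthogonal_complement_line[OF \<nu>0 Pe])
  have Q\<nu>: "Q = q *\<^sub>R \<nu>1" unfolding q_def by (rule orthogonal_complement_line[OF \<nu>1 Qe])
  have "\<rho> > 0" using \<rho> by (meson le_less_trans mult_nonneg_nonneg of_nat_0_le_iff zero_le_numeral)
  then have "P \<bullet> P > 0" unfolding ids(1) using \<open>c > 0\<close> b(2) by (simp add: add_pos_pos)
  then have "p \<noteq> 0" using P\<nu> by auto
  have A: "orthogonal_transformation A" by (simp add: A_def orthogonal_transformation_reflection)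
  have iA: "A v \<bullet> A w = v \<bullet> w" for v w using A by (simp add: orthogonal_transformation_def)
  \<comment> \<open>Dividing by \<open>a * p\<close> puts \<open>A \<nu>0\<close> on the line of
    \<open>\<nu>1\<close>, and \<open>A\<close> preserves length. The sign stays open, but the trace
    formula accepts both.\<close>
  have A\<nu>: "A \<nu>0 = \<nu>1 \<or> A \<nu>0 = - \<nu>1"
  proof -
    define t where "t = b * q / (a * p)"
    have "(a * p) *\<^sub>R A \<nu>0 = (b * q) *\<^sub>R \<nu>1"
      using ids(3) by (simp add: P\<nu> Q\<nu> orthogonal_transformation_scaleR[OF A])
    then have "(1 / (a * p)) *\<^sub>R ((a * p) *\<^sub>R A \<nu>0) = (1 / (a * p)) *\<^sub>R ((b * q) *\<^sub>R \<nu>1)"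
      by simp
    then have t: "A \<nu>0 = t *\<^sub>R \<nu>1" using \<open>p \<noteq> 0\<close> a(2) by (simp add: t_def)
    then have "\<bar>t\<bar> = 1" using orthogonal_transformation_norm[OF A, of \<nu>0] \<nu>0 \<nu>1 by simp
    then show ?thesis using t by (auto simp: abs_if split: if_splits)
  qed
  obtain b0 :: 'a where b0: "b0 \<in> Basis" using nonempty_Basis by blast
  define T where "T = reflection (b0 - \<nu>0)"
  have T: "orthogonal_transformation T" "T b0 = \<nu>0"
    using b0 \<nu>0 by (auto simp: T_def orthogonal_transformation_reflection reflection_swap)
  have iT: "T v \<bullet> T w = v \<bullet> w" for v w using T(1) by (simp add: orthogonal_transformation_def)
  \<comment> \<open>Since \<open>A (T b0)\<close> is \<open>\<nu>1\<close> up to sign, the index set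
    \<open>Basis - {b0}\<close> yields tangent bases at both points simultaneously.\<close>
  have AT: "orthogonal_transformation (\<lambda>v. A (T v))"
    using orthogonal_transformation_compose[OF A T(1)] by (simp add: o_def)
  have "0 \<le> (\<Sum>i\<in>Basis - {b0}. c * (a + b) + 2 * p * \<kappa>0 (T i) + 2 * q * \<kappa>1 (A (T i)))"
  proof (rule sum_nonneg)
    fix i assume i: "i \<in> Basis - {b0}"
    define e where "e = T i"
    have e: "e \<bullet> \<nu>0 = 0" "e \<bullet> e = 1"
      using iT[of i b0] iT[of i i] i b0 by (auto simp: T(2) inner_Basis e_def)
    have Ae: "A e \<bullet> A e = 1" "A e \<bullet> \<nu>1 = 0"
      using e A\<nu> iA[of e e] iA[of e \<nu>0] by auto
    have "(1 + c * b) + (1 + c * a) - 2 * (e \<bullet> A e) - 4 * c * ((x \<bullet> e) * (y \<bullet> A e))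
        + 2 * (P \<bullet> (\<kappa>0 e *\<^sub>R \<nu>0)) + 2 * (Q \<bullet> (\<kappa>1 (A e) *\<^sub>R \<nu>1)) \<ge> 0"
      using var(2)[OF curves0[OF e(1)] curves1[OF Ae(2)]] Pe[OF e(1)] Qe[OF Ae(2)] e(2) Ae(1) by simp
    \<comment> \<open>The mixed terms thus equal -2, which cancels the two constants 1 and leaves
      \<open>c * (a + b)\<close>.\<close>
    moreover have "e \<bullet> A e + 2 * c * ((x \<bullet> e) * (y \<bullet> A e)) = 1"
      using ids(4)[OF Pe[OF e(1)]] e(2) by simp
    ultimately have "c * (a + b) + 2 * p * \<kappa>0 e + 2 * q * \<kappa>1 (A e) \<ge> 0"
      by (simp add: p_def[symmetric] q_def[symmetric] algebra_simps)
    then show "c * (a + b) + 2 * p * \<kappa>0 (T i) + 2 * q * \<kappa>1 (A (T i)) \<ge> 0"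
      by (simp add: e_def)
  qed
  also have "\<dots> = real (DIM('a) - 1) * (c * (a + b)) - (p * (x \<bullet> \<nu>0) + q * (y \<bullet> \<nu>1)) / 2"
    using trace0[OF T(1) b0] trace1[OF AT b0] b0 T(2) A\<nu>
    by (simp add: sum.distrib sum_distrib_left[symmetric] card_Diff_singleton field_simps)
  also have "p * (x \<bullet> \<nu>0) + q * (y \<bullet> \<nu>1) = x \<bullet> P + y \<bullet> Q"
    by (simp add: P\<nu> Q\<nu>)
  also have "\<dots> = c * (\<rho> * (a + b) - a * b)"
    by (rule ids(2))
  finally have "0 \<le> real (DIM('a) - 1) * (c * (a + b)) - c * (\<rho> * (a + b) - a * b) / 2" .
  moreover have "c * (2 * m * (a + b) - k) = 2 * (m * (c * (a + b)) - c * k / 2)" for m k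
    by (simp add: algebra_simps)
  ultimately have "0 \<le> c * (2 * real (DIM('a) - 1) * (a + b) - (\<rho> * (a + b) - a * b))"
    by (simp only: zero_le_mult_iff) simp
  then have 1: "\<rho> * (a + b) - a * b \<le> 2 * real (DIM('a) - 1) * (a + b)"
    using \<open>c > 0\<close> by (simp add: zero_le_mult_iff)
  \<comment> \<open>The source of the constant 4: adding the two bounds below shows that
    \<open>a * b\<close> is at most half of \<open>\<rho> * (a + b)\<close>, which doubles the 2 in
    the preceding inequality.\<close>
  have "a \<le> \<rho>" "b \<le> \<rho>" using a b by auto
  then have "a * b \<le> \<rho> * b" "a * b \<le> \<rho> * a"
    using a(2) b(2) by (auto intro: mult_mono simp: mult.commute)
  with 1 have "\<rho> * (a + b) \<le> 4 * real (DIM('a) - 1) * (a + b)"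
    by (simp add: algebra_simps)
  then have "\<rho> \<le> 4 * real (DIM('a) - 1)" using a(2) b(2) by simp
  with \<rho> show False by simp
qed

theorem theorem3:
  fixes S0 S1 :: "'a::euclidean_space set"
  assumes "shrinker S0" and "shrinker S1"
  shows "cball 0 (2 * sqrt (real (DIM('a) - 1))) \<inter> S0 \<inter> S1 \<noteq> {}"
proof
  define n where "n = real (DIM('a) - 1)"
  define r where "r = 2 * sqrt n"
  have n: "n \<ge> 0" by (simp add: n_def)
  have r: "r \<ge> 0" "r\<^sup>2 = 4 * n" using n by (auto simp: r_def power_mult_distrib)
  assume "cball 0 (2 * sqrt (real (DIM('a) - 1))) \<inter> S0 \<inter> S1 = {}"
  then have disj: "cball 0 r \<inter> (S0 \<inter> S1) = {}" by (simp add: r_def n_def Int_assoc)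
  note cl = shrinker_closed[OF assms(1)] shrinker_closed[OF assms(2)]
  \<comment> \<open>Closedness gives a common point nearest to the origin, outside the closed ball
    of radius \<open>r\<close>; a radius halfway to it makes \<open>\<rho> > 4 * n\<close>
    strict.\<close>
  obtain R where R: "R > r" "cball 0 R \<inter> (S0 \<inter> S1) = {}"
  proof (cases "S0 \<inter> S1 = {}")
    case True
    then show thesis using that[of "r + 1"] by auto
  next
    case False
    obtain z where z: "z \<in> S0 \<inter> S1" "\<And>x. x \<in> S0 \<inter> S1 \<Longrightarrow> dist 0 z \<le> dist 0 x"
      using distance_attains_inf[OF closed_Int[OF cl] False] by metis
    have "norm z > r" using z(1) disj by (force simp: not_le[symmetric])
    then show thesis using that[of "(r + norm z) / 2"] z(2) by fastforce
  qed
  define \<rho> where "\<rho> = R\<^sup>2"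
  have R0: "R > 0" using r R(1) by simp
  have \<rho>: "\<rho> > 4 * n" using R(1) r power_strict_mono[of r R 2] by (simp add: \<rho>_def)
  have ball: "norm x \<le> R \<longleftrightarrow> x \<bullet> x \<le> \<rho>" for x :: 'a
    using R0 by (simp add: \<rho>_def norm_le_square)
  define K where "K = (cball 0 R \<inter> S0) \<times> (cball 0 R \<inter> S1)"
  \<comment> \<open>The reciprocal of the quotient to be minimised: it remains continuous on the
    bounding sphere, where it is 0.\<close>
  define h where "h w = (\<rho> - fst w \<bullet> fst w) * (\<rho> - snd w \<bullet> snd w) / ((fst w - snd w) \<bullet> (fst w - snd w))"
    for w :: "'a \<times> 'a"
  have ne: "fst w - snd w \<noteq> 0" if "w \<in> K" for w
    using that R(2) by (auto simp: K_def)
  have "compact K" unfolding K_def using cl by (intro compact_Times compact_Int_closed) auto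
  moreover have "continuous_on K h"
    unfolding h_def using ne by (intro continuous_intros) auto
  \<comment> \<open>These points lie strictly inside the ball because 2 n < \<open>\<rho>\<close>,
    so the maximum of \<open>h\<close> is positive.\<close>
  moreover obtain x1 where x1: "x1 \<in> S0" "x1 \<bullet> x1 \<le> 2 * n"
    using shrinker_meets_ball[OF assms(1)] unfolding n_def .
  obtain y1 where y1: "y1 \<in> S1" "y1 \<bullet> y1 \<le> 2 * n"
    using shrinker_meets_ball[OF assms(2)] unfolding n_def .
  have lt: "x1 \<bullet> x1 < \<rho>" "y1 \<bullet> y1 < \<rho>" using x1 y1 \<rho> n by auto
  have K1: "(x1, y1) \<in> K"
    using x1 y1 lt by (auto simp: K_def ball)
  then have "K \<noteq> {}" by blast
  ultimately obtain w where w: "w \<in> K" "\<And>v. v \<in> K \<Longrightarrow> h v \<le> h w"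
    using continuous_attains_sup by metis
  obtain x y where xy: "w = (x, y)" by fastforce
  define a where "a = \<rho> - x \<bullet> x"
  define b where "b = \<rho> - y \<bullet> y"
  have "h (x1, y1) > 0" using lt ne[OF K1] by (simp add: h_def)
  with w(2)[OF K1] have hw: "h w > 0" by simp
  have dpos: "(x - y) \<bullet> (x - y) > 0" using ne[OF w(1)] xy by simp
  have hab: "h w = a * b / ((x - y) \<bullet> (x - y))" by (simp add: h_def xy a_def b_def)
  \<comment> \<open>A positive maximum excludes the sphere, where \<open>a\<close> or
    \<open>b\<close> would vanish.\<close>
  have "a \<ge> 0" "b \<ge> 0" using w(1) by (auto simp: K_def xy a_def b_def ball)
  moreover have "a * b > 0" using hw dpos unfolding hab by (simp add: zero_less_divide_iff)
  ultimately have ab: "a > 0" "b > 0" by (auto simp: zero_less_mult_iff)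
  define c where "c = 1 / h w"
  have c: "c > 0" using hw by (simp add: c_def)
  have bound: "c * ((\<rho> - x \<bullet> x) * (\<rho> - y \<bullet> y)) \<le> (x - y) \<bullet> (x - y)"
    if "x \<in> S0" "y \<in> S1" "x \<bullet> x < \<rho>" "y \<bullet> y < \<rho>" for x y
  proof -
    have v: "(x, y) \<in> K" using that by (auto simp: K_def ball)
    have "(x - y) \<bullet> (x - y) > 0" using ne[OF v] by simp
    then have "(\<rho> - x \<bullet> x) * (\<rho> - y \<bullet> y) \<le> h w * ((x - y) \<bullet> (x - y))"
      using w(2)[OF v] by (simp add: h_def[of "(x, y)"] pos_divide_le_eq)
    then show ?thesis using hw by (simp add: c_def pos_divide_le_eq mult.commute)
  qed
  have eq: "(x - y) \<bullet> (x - y) = c * (a * b)"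
    using dpos ab by (simp add: c_def hab)
  have "x \<in> S0" "y \<in> S1" using w(1) by (auto simp: K_def xy)
  from shrinkers_no_interior_minimum[OF assms this c \<rho>[unfolded n_def] bound a_def ab(1) b_def ab(2) eq]
  show False .
qed

end
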